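(* The class of complex unimodular matroids equals the class of sixth-root-of-unity matroids.
   Context: For a field $F$ and a subgroup $G$ of $F^*=F\setminus\{0\}$, a matrix over $F$ is an $(F,G)$-matrix if every nonzero square subdeterminant of it lies in $G$; a matroid is $(F,G)$-representable if it is representable over $F$ by an $(F,G)$-matrix. Complex unimodular matroids are the $(\mathbb C,U(1))$-representable matroids, where $U(1)$ is the group of complex numbers of modulus $1$; sixth-root-of-unity matroids are the $(\mathbb C,\mathbb Z_6)$-representable matroids, where $\mathbb Z_6$ is the multiplicative group of complex sixth roots of unity. *)

theory Defs
  imports Complex_Main "Jordan_Normal_Form.DL_Rank_Submatrix"
begin

locale matroid =
  fixes E :: "'a set" and \<I> :: "'a set set"
  assumes finite_ground: "finite E"
    and indep_subset_ground: "X \<in> \<I> \<Longrightarrow> X \<subseteq> E"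
    and indep_empty: "{} \<in> \<I>"
    and indep_subset: "Y \<in> \<I> \<Longrightarrow> X \<subseteq> Y \<Longrightarrow> X \<in> \<I>"
    and augmentation: "X \<in> \<I> \<Longrightarrow> Y \<in> \<I> \<Longrightarrow> card X < card Y \<Longrightarrow> \<exists>y \<in> Y - X. insert y X \<in> \<I>"

(* Injectivity is needed because equal columns with different indices are linearly dependent as a
   family, whereas lin_dep only sees the set of their values. *)
definition cols_indep :: "'f::field mat \<Rightarrow> nat set \<Rightarrow> bool" where
  "cols_indep A J \<longleftrightarrow> inj_on (col A) J \<and>
     \<not> LinearCombinations.module.lin_dep class_ring (module_vec TYPE('f) (dim_row A)) (col A ` J)"

(* The bijection f labels the columns of A by the elements of the ground set. *)
definition represents :: "'f::field mat \<Rightarrow> 'a set \<Rightarrow> 'a set set \<Rightarrow> bool" where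
  "represents A E \<I> \<longleftrightarrow>
     (\<exists>f. bij_betw f {..<dim_col A} E \<and>
          \<I> = {f ` J |J. J \<subseteq> {..<dim_col A} \<and> cols_indep A J})"

definition FG_matrix :: "'f::field set \<Rightarrow> 'f mat \<Rightarrow> bool" where
  "FG_matrix G A \<longleftrightarrow>
     (\<forall>I J. I \<subseteq> {..<dim_row A} \<longrightarrow> J \<subseteq> {..<dim_col A} \<longrightarrow> card I = card J \<longrightarrow>
            det (submatrix A I J) \<noteq> 0 \<longrightarrow> det (submatrix A I J) \<in> G)"

definition FG_representable :: "'f::field set \<Rightarrow> 'a set \<Rightarrow> 'a set set \<Rightarrow> bool" where
  "FG_representable G E \<I> \<longleftrightarrow> (\<exists>A :: 'f mat. FG_matrix G A \<and> represents A E \<I>)"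

definition U1 :: "complex set" where
  "U1 = {z. cmod z = 1}"

definition Z6 :: "complex set" where
  "Z6 = {z. z ^ 6 = 1}"

lemma subgroup_field_unitsI:
  fixes G :: "'f::field set"
  assumes "0 \<notin> G" "1 \<in> G" "\<And>x y. x \<in> G \<Longrightarrow> y \<in> G \<Longrightarrow> x * y \<in> G" "\<And>x. x \<in> G \<Longrightarrow> inverse x \<in> G"
  shows "subgroup G (units_of (class_ring :: 'f ring))"
proof -
  have U: "Units (class_ring :: 'f ring) = UNIV - {0}"
    by (simp add: class_field.field_Units)
  interpret U: group "units_of (class_ring :: 'f ring)"
    by (rule monoid.units_group) (rule class_semiring.monoid_axioms)
  have inv: "inv\<^bsub>units_of (class_ring :: 'f ring)\<^esub> x = inverse x" if "x \<in> G" for x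
  proof -
    have "x \<noteq> 0" using that assms(1) by auto
    then show ?thesis by (intro U.inv_equality) (auto simp: units_of_def U)
  qed
  show ?thesis
    by unfold_locales (use assms inv in \<open>auto simp: units_of_def U\<close>)
qed

lemma subgroup_U1: "subgroup U1 (units_of class_ring)"
  by (rule subgroup_field_unitsI) (auto simp: U1_def norm_mult norm_inverse)

lemma subgroup_Z6: "subgroup Z6 (units_of class_ring)"
  by (rule subgroup_field_unitsI) (auto simp: Z6_def power_mult_distrib power_inverse)

definition complex_unimodular_matroids :: "('a set \<times> 'a set set) set" where
  "complex_unimodular_matroids = {(E, \<I>). matroid E \<I> \<and> FG_representable U1 E \<I>}"

definition sixth_root_of_unity_matroids :: "('a set \<times> 'a set set) set" where
  "sixth_root_of_unity_matroids = {(E, \<I>). matroid E \<I> \<and> FG_representable Z6 E \<I>}"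

end

theory Submission
  imports Defs
begin

text \<open>
  View the nonzero entries of a \<open>U(1)\<close>-matrix as edges of a bipartite graph on rows and columns.
  The determinant of the submatrix on an induced cycle has two terms of modulus 1, so their ratio
  \<open>u\<close> satisfies \<open>|1 + u| \<in> {0, 1}\<close>, which forces \<open>u\<close> to be a sixth root of unity. Since induced
  cycles generate the cycle space, rows and columns can be scaled by unit complex numbers so that
  all nonzero entries are sixth roots of unity. Scaling changes neither the matroid nor the moduli
  of the subdeterminants; these are now Eisenstein integers of modulus 0 or 1, and the Eisenstein
  integers of modulus 1 are exactly the sixth roots of unity.
\<close>

section \<open>Sixth roots of unity and Eisenstein integers\<close>

lemma Z6_mult: "x \<in> Z6 \<Longrightarrow> y \<in> Z6 \<Longrightarrow> x * y \<in> Z6"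
  by (simp add: Z6_def power_mult_distrib)

lemma Z6_divide: "x \<in> Z6 \<Longrightarrow> y \<in> Z6 \<Longrightarrow> x / y \<in> Z6"
  by (simp add: Z6_def power_divide)

lemma Z6_prod: "(\<And>x. x \<in> S \<Longrightarrow> f x \<in> Z6) \<Longrightarrow> (\<Prod>x\<in>S. f x) \<in> Z6"
  by (simp add: Z6_def prod_power_distrib)

lemma Z6_minus_one_power: "(-1) ^ k \<in> Z6"
  by (simp add: Z6_def flip: power_mult)

lemma Z6_nonzero: "x \<in> Z6 \<Longrightarrow> x \<noteq> 0"
  by (auto simp: Z6_def)

lemma Z6_subset_U1: "Z6 \<subseteq> U1"
proof
  fix z assume "z \<in> Z6"
  then have "cmod z ^ 6 = 1"
    by (simp add: Z6_def flip: norm_power)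
  then show "z \<in> U1"
    using power_eq_iff_eq_base[of 6 "cmod z" 1] by (simp add: U1_def)
qed

text \<open>For \<open>cmod u = 1\<close> the square of \<open>cmod (1 + u)\<close> is
  \<open>2 + 2 * Re u\<close>. The two allowed moduli leave \<open>Re u = -1\<close>, hence
  \<open>u = -1\<close>, or \<open>Re u = -1/2\<close>, hence a primitive cube root of
  unity.\<close>

lemma unit_shift_in_Z6:
  assumes "cmod u = 1" and "cmod (1 + u) \<in> {0, 1}"
  shows "u \<in> Z6"
proof -
  have n: "(Re u)\<^sup>2 + (Im u)\<^sup>2 = 1"
    using assms(1) by (metis cmod_power2 power_one)
  have "(1 + Re u)\<^sup>2 + (Im u)\<^sup>2 \<in> {0, 1}"
    using assms(2) cmod_power2[of "1 + u"] by auto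
  then consider "Re u = -1" | "Re u = -1/2"
    using n by (auto simp: power2_eq_square algebra_simps)
  then show ?thesis
  proof cases
    case 1
    then have "u = -1"
      using n by (simp add: complex_eq_iff)
    then show ?thesis by (simp add: Z6_def)
  next
    case 2
    then have "(Im u)\<^sup>2 = 3/4"
      using n by (simp add: power2_eq_square)
    then have q: "u * u + u + 1 = 0"
      using 2 by (simp add: complex_eq_iff power2_eq_square)
    have "u ^ 3 - 1 = (u - 1) * (u * u + u + 1)"
      by (simp add: power3_eq_cube algebra_simps)
    then have "u ^ 3 = 1"
      using q by simp
    then have "(u ^ 3) ^ 2 = 1"
      by simp
    then show ?thesis
      by (simp add: Z6_def flip: power_mult)
  qed
qed

text \<open>The primitive cube root of unity with positive imaginary part.\<close>

definition omega :: complex where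
  "omega = Complex (-1/2) (sqrt 3 / 2)"

definition eisenstein :: "complex set" where
  "eisenstein = {of_int a + of_int b * omega |a b. True}"

lemma omega_square: "omega * omega = -1 - omega"
  by (simp add: omega_def complex_eq_iff)

lemma eisensteinI: "z = of_int a + of_int b * omega \<Longrightarrow> z \<in> eisenstein"
  by (auto simp: eisenstein_def)

lemma eisenstein_0: "0 \<in> eisenstein"
  by (rule eisensteinI[of _ 0 0]) simp

lemma eisenstein_1: "1 \<in> eisenstein"
  by (rule eisensteinI[of _ 1 0]) simp

lemma eisenstein_minus: "x \<in> eisenstein \<Longrightarrow> - x \<in> eisenstein"
proof -
  assume "x \<in> eisenstein"
  then obtain a b where "x = of_int a + of_int b * omega"
    by (auto simp: eisenstein_def)
  then show ?thesis
    by (intro eisensteinI[of _ "-a" "-b"]) simp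
qed

lemma eisenstein_add:
  assumes "x \<in> eisenstein" "y \<in> eisenstein"
  shows "x + y \<in> eisenstein"
proof -
  obtain a b c d where "x = of_int a + of_int b * omega" "y = of_int c + of_int d * omega"
    using assms by (auto simp: eisenstein_def)
  then show ?thesis
    by (intro eisensteinI[of _ "a + c" "b + d"]) (simp add: algebra_simps)
qed

lemma eisenstein_mult:
  assumes "x \<in> eisenstein" "y \<in> eisenstein"
  shows "x * y \<in> eisenstein"
proof -
  obtain a b c d where xy: "x = of_int a + of_int b * omega" "y = of_int c + of_int d * omega"
    using assms by (auto simp: eisenstein_def)
  have "x * y = of_int (a * c) + of_int (a * d + b * c) * omega + of_int (b * d) * (omega * omega)"
    by (simp add: xy algebra_simps)
  then show ?thesis
    unfolding omega_square
    by (intro eisensteinI[of _ "a * c - b * d" "a * d + b * c - b * d"]) (simp add: algebra_simps)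
qed

lemma eisenstein_sum: "(\<And>x. x \<in> S \<Longrightarrow> f x \<in> eisenstein) \<Longrightarrow> sum f S \<in> eisenstein"
  by (induction S rule: infinite_finite_induct) (auto intro: eisenstein_0 eisenstein_add)

lemma eisenstein_prod: "(\<And>x. x \<in> S \<Longrightarrow> f x \<in> eisenstein) \<Longrightarrow> prod f S \<in> eisenstein"
  by (induction S rule: infinite_finite_induct) (auto intro: eisenstein_1 eisenstein_mult)

lemma Z6_subset_eisenstein: "Z6 \<subseteq> eisenstein"
proof
  fix z assume "z \<in> Z6"
  \<comment> \<open>The factors are the cyclotomic polynomials of orders 1, 2, 3 and 6. The two
    quadratic ones split over \<open>omega\<close>, so all six roots can be read off in the form
    \<open>a + b * omega\<close>.\<close>
  have "z ^ 6 - 1 = (z - 1) * (z + 1) * (z * z + z + 1) * (z * z - z + 1)"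
    by (simp add: eval_nat_numeral algebra_simps)
  moreover have "z * z + z + 1 = (z - omega) * (z + 1 + omega)"
    using omega_square by (simp add: algebra_simps)
  moreover have "z * z - z + 1 = (z + omega) * (z - 1 - omega)"
    using omega_square by (simp add: algebra_simps)
  ultimately have "(z - 1) * (z + 1) * ((z - omega) * (z + 1 + omega)) * ((z + omega) * (z - 1 - omega)) = 0"
    using \<open>z \<in> Z6\<close> by (simp add: Z6_def)
  then consider "z = 1" | "z = -1" | "z = omega" | "z = -1 - omega" | "z = - omega" | "z = 1 + omega"
    unfolding mult_eq_0_iff by (auto simp: algebra_simps eq_neg_iff_add_eq_0)
  then show "z \<in> eisenstein"
  proof cases
    case 1 then show ?thesis by (intro eisensteinI[of _ 1 0]) simp
  next
    case 2 then show ?thesis by (intro eisensteinI[of _ "-1" 0]) simp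
  next
    case 3 then show ?thesis by (intro eisensteinI[of _ 0 1]) simp
  next
    case 4 then show ?thesis by (intro eisensteinI[of _ "-1" "-1"]) simp
  next
    case 5 then show ?thesis by (intro eisensteinI[of _ 0 "-1"]) simp
  next
    case 6 then show ?thesis by (intro eisensteinI[of _ 1 1]) simp
  qed
qed

text \<open>The squared modulus of \<open>a + b * omega\<close> is the positive definite form
  \<open>a * a - a * b + b * b\<close>, which takes the value 1 at only six integer pairs.\<close>

lemma eisenstein_unit_in_Z6:
  assumes "z \<in> eisenstein" and "cmod z = 1"
  shows "z \<in> Z6"
proof -
  obtain a b where z: "z = of_int a + of_int b * omega"
    using assms(1) by (auto simp: eisenstein_def)
  have "(cmod z)\<^sup>2 = real_of_int (a * a - a * b + b * b)"
    unfolding z cmod_power2 by (simp add: omega_def power2_eq_square algebra_simps)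
  then have "real_of_int (a * a - a * b + b * b) = of_int 1"
    using assms(2) by simp
  then have n: "a * a - a * b + b * b = 1"
    by (simp only: of_int_eq_iff)
  \<comment> \<open>Four times the norm equation, with the square completed in either variable; this
    bounds both coordinates by 1 in absolute value.\<close>
  have sq: "(2 * a - b)\<^sup>2 + 3 * b\<^sup>2 = 4" "(2 * b - a)\<^sup>2 + 3 * a\<^sup>2 = 4"
    using n by (simp_all add: power2_eq_square algebra_simps)
  have "b\<^sup>2 < 4"
    using sq(1) zero_le_power2[of "2 * a - b"] by linarith
  moreover have "a\<^sup>2 < 4"
    using sq(2) zero_le_power2[of "2 * b - a"] by linarith
  ultimately have "\<bar>b\<bar> < 2" "\<bar>a\<bar> < 2"
    using power2_less_imp_less[of "\<bar>b\<bar>" 2] power2_less_imp_less[of "\<bar>a\<bar>" 2] by simp_all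
  then have "a \<in> {-1, 0, 1}" "b \<in> {-1, 0, 1}"
    by auto
  then have cases: "z \<in> {1, -1, omega, -omega, 1 + omega, -1 - omega}"
    using n z by auto
  have o3: "omega ^ 3 = 1"
    by (simp add: power3_eq_cube mult.assoc omega_square) (simp add: omega_square algebra_simps)
  have o6: "omega ^ 6 = 1"
    using o3 power_mult[of omega 3 2] by simp
  have "(1 + omega) = - (omega * omega)"
    by (simp add: omega_square)
  then have "(1 + omega) ^ 6 = (omega ^ 6)\<^sup>2"
    by (simp add: power_mult_distrib power2_eq_square)
  then have s6: "(1 + omega) ^ 6 = 1"
    by (simp add: o6)
  moreover have "-1 - omega = - (1 + omega)"
    by simp
  ultimately have "(-1 - omega) ^ 6 = 1"
    by (simp only: power_minus_even even_numeral)
  then show ?thesis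
    using cases o6 s6 by (auto simp: Z6_def)
qed

section \<open>Minors of unit modulus\<close>

text \<open>Rows and columns may be repeated and permuted, which changes a minor at most by a sign or
  makes it zero; this avoids sorting the vertices of a cycle.\<close>

definition unimodular_minors :: "nat \<Rightarrow> nat \<Rightarrow> (nat \<Rightarrow> nat \<Rightarrow> complex) \<Rightarrow> bool" where
  "unimodular_minors m n a \<longleftrightarrow>
     (\<forall>k i j. (\<forall>s<k. i s < m \<and> j s < n) \<longrightarrow>
        cmod (det (mat k k (\<lambda>(s, t). a (i s) (j t)))) \<in> {0, 1})"

lemma unimodular_minorsD:
  assumes "unimodular_minors m n a" "\<And>s. s < k \<Longrightarrow> i s < m" "\<And>s. s < k \<Longrightarrow> j s < n"
  shows "cmod (det (mat k k (\<lambda>(s, t). a (i s) (j t)))) \<in> {0, 1}"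
  using assms unfolding unimodular_minors_def by blast

text \<open>\<open>submatrix\<close> lists its rows and columns in increasing order by
  \<open>pick\<close>. The permutation found here passes from that order to an arbitrary injective
  enumeration.\<close>

lemma pick_permutation:
  assumes inj: "inj_on i {..<k}"
  obtains p where "p permutes {0..<k}" and "\<And>s. s < k \<Longrightarrow> pick (i ` {..<k}) (p s) = i s"
proof -
  let ?I = "i ` {..<k}"
  have card: "card ?I = k"
    using inj by (simp add: card_image)
  \<comment> \<open>The rank of \<open>i s\<close> within the image. Outside the index range it is
    the identity, as \<open>permutes\<close> demands.\<close>
  define p where "p s = (if s < k then card {a \<in> ?I. a < i s} else s)" for s
  have pick: "pick ?I (p s) = i s" if "s < k" for s
    using that by (simp add: p_def pick_card_in_set)
  have less: "p s < k" if "s < k" for s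
  proof -
    have "{a \<in> ?I. a < i s} \<subset> ?I"
      using that by auto
    then have "card {a \<in> ?I. a < i s} < card ?I"
      by (intro psubset_card_mono) auto
    then show ?thesis
      using that card by (simp add: p_def)
  qed
  have "inj_on p {0..<k}"
    using pick inj by (intro inj_onI) (metis atLeastLessThan_iff inj_onD lessThan_iff)
  moreover have "p ` {0..<k} \<subseteq> {0..<k}"
    using less by auto
  ultimately have "bij_betw p {0..<k} {0..<k}"
    by (simp add: bij_betw_def endo_inj_surj)
  then have "p permutes {0..<k}"
    by (rule bij_imp_permutes) (simp add: p_def)
  then show thesis
    using pick that by blast
qed

lemma FG_matrix_U1_imp_unimodular_minors:
  assumes A: "FG_matrix U1 A"
  shows "unimodular_minors (dim_row A) (dim_col A) (\<lambda>i j. A $$ (i, j))"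
  unfolding unimodular_minors_def
proof (intro allI impI)
  fix k and i j :: "nat \<Rightarrow> nat"
  assume bound: "\<forall>s<k. i s < dim_row A \<and> j s < dim_col A"
  let ?M = "mat k k (\<lambda>(s, t). A $$ (i s, j t))"
  show "cmod (det ?M) \<in> {0, 1}"
  proof (cases "inj_on i {..<k} \<and> inj_on j {..<k}")
    case False
    have "det ?M = 0"
    proof (cases "inj_on i {..<k}")
      case True
      then obtain s t where "s < k" "t < k" "s \<noteq> t" "j s = j t"
        using False by (auto simp: inj_on_def)
      then show ?thesis
        by (intro det_identical_columns[of _ k s t]) auto
    next
      case False
      then obtain s t where "s < k" "t < k" "s \<noteq> t" "i s = i t"
        by (auto simp: inj_on_def)
      then show ?thesis
        by (intro det_identical_rows[of _ k s t]) auto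
    qed
    then show ?thesis by simp
  next
    case True
    let ?I = "i ` {..<k}" and ?J = "j ` {..<k}"
    obtain p where p: "p permutes {0..<k}" "\<And>s. s < k \<Longrightarrow> pick ?I (p s) = i s"
      using pick_permutation True by blast
    obtain q where q: "q permutes {0..<k}" "\<And>s. s < k \<Longrightarrow> pick ?J (q s) = j s"
      using pick_permutation True by blast
    have plt: "p s < k" "q s < k" if "s < k" for s
      using that permutes_in_image[OF p(1), of s] permutes_in_image[OF q(1), of s] by auto
    have card: "card ?I = k" "card ?J = k"
      using True by (simp_all add: card_image)
    have sub: "?I \<subseteq> {..<dim_row A}" "?J \<subseteq> {..<dim_col A}"
      using bound by auto
    have setI: "{x. x < dim_row A \<and> x \<in> ?I} = ?I" and setJ: "{x. x < dim_col A \<and> x \<in> ?J} = ?J"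
      using sub by auto
    let ?S = "submatrix A ?I ?J"
    have S: "?S = mat k k (\<lambda>(s, t). A $$ (pick ?I s, pick ?J t))"
      unfolding submatrix_def setI setJ card ..
    have Sc: "?S \<in> carrier_mat k k"
      unfolding S by simp
    \<comment> \<open>Columns are permuted as rows of the transpose, so that
      \<open>det_permute_rows\<close> serves for both \<open>p\<close> and \<open>q\<close>.\<close>
    let ?T = "(mat k k (\<lambda>(s, t). ?S $$ (p s, t)))\<^sup>T"
    have M: "?M = (mat k k (\<lambda>(s, t). ?T $$ (q s, t)))\<^sup>T"
      by (rule eq_matI) (use p(2) q(2) plt in \<open>auto simp: S\<close>)
    have "det ?M = det (mat k k (\<lambda>(s, t). ?T $$ (q s, t)))"
      unfolding M by (rule det_transpose[of _ k]) simp
    also have "\<dots> = signof q * det ?T"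
      by (rule det_permute_rows) (use q(1) in auto)
    also have "det ?T = det (mat k k (\<lambda>(s, t). ?S $$ (p s, t)))"
      by (rule det_transpose[of _ k]) simp
    also have "\<dots> = signof p * det ?S"
      by (rule det_permute_rows[OF Sc p(1)])
    finally have "cmod (det ?M) = cmod (det ?S)"
      by (simp add: norm_mult sign_def)
    moreover have "det ?S = 0 \<or> det ?S \<in> U1"
      using A sub card unfolding FG_matrix_def by metis
    ultimately show ?thesis
      by (auto simp: U1_def)
  qed
qed

section \<open>Scaling rows and columns of a minor\<close>

text \<open>Each Leibniz term takes one entry from every row and every column, so it picks up each
  factor exactly once.\<close>

lemma det_scale_rows_cols:
  fixes x y :: "nat \<Rightarrow> 'b::comm_ring_1"
  shows "det (mat k k (\<lambda>(s, t). x s * b s t * y t)) =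
    (\<Prod>s = 0..<k. x s) * (\<Prod>s = 0..<k. y s) * det (mat k k (\<lambda>(s, t). b s t))"
proof -
  let ?P = "{p. p permutes {0..<k}}"
  have "(\<Prod>s = 0..<k. mat k k (\<lambda>(s, t). x s * b s t * y t) $$ (s, p s)) =
      (\<Prod>s = 0..<k. x s) * (\<Prod>s = 0..<k. y s) * (\<Prod>s = 0..<k. mat k k (\<lambda>(s, t). b s t) $$ (s, p s))"
    if p: "p \<in> ?P" for p
  proof -
    have lt: "p s < k" if "s < k" for s
      using that p permutes_in_image[of p "{0..<k}" s] by auto
    have "(\<Prod>s = 0..<k. mat k k (\<lambda>(s, t). x s * b s t * y t) $$ (s, p s)) =
        (\<Prod>s = 0..<k. x s * b s (p s) * y (p s))"
      by (rule prod.cong) (auto simp: lt)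
    also have "\<dots> = (\<Prod>s = 0..<k. x s) * (\<Prod>s = 0..<k. b s (p s)) * (\<Prod>s = 0..<k. y (p s))"
      by (simp add: prod.distrib)
    also have "(\<Prod>s = 0..<k. y (p s)) = (\<Prod>s = 0..<k. y s)"
      using p prod.permute[of p "{0..<k}" y] by (simp add: o_def)
    also have "(\<Prod>s = 0..<k. b s (p s)) = (\<Prod>s = 0..<k. mat k k (\<lambda>(s, t). b s t) $$ (s, p s))"
      by (rule prod.cong) (auto simp: lt)
    finally show ?thesis
      by (simp add: mult_ac)
  qed
  then show ?thesis
    by (simp add: det_def'[of _ k] sum_distrib_left mult_ac)
qed

lemma unimodular_minors_scale:
  assumes a: "unimodular_minors m n a"
    and r: "\<And>i. i < m \<Longrightarrow> cmod (r i) = 1" and c: "\<And>j. j < n \<Longrightarrow> cmod (c j) = 1"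
  shows "unimodular_minors m n (\<lambda>i j. r i * a i j * c j)"
  unfolding unimodular_minors_def
proof (intro allI impI)
  fix k and i j :: "nat \<Rightarrow> nat"
  assume bound: "\<forall>s<k. i s < m \<and> j s < n"
  have "cmod (\<Prod>s = 0..<k. r (i s)) = 1" "cmod (\<Prod>s = 0..<k. c (j s)) = 1"
    using bound r c by (simp_all flip: prod_norm)
  moreover have "cmod (det (mat k k (\<lambda>(s, t). a (i s) (j t)))) \<in> {0, 1}"
    using a bound unfolding unimodular_minors_def by blast
  ultimately show "cmod (det (mat k k (\<lambda>(s, t). r (i s) * a (i s) (j t) * c (j t)))) \<in> {0, 1}"
    unfolding det_scale_rows_cols[of k "\<lambda>s. r (i s)" "\<lambda>s t. a (i s) (j t)" "\<lambda>t. c (j t)"]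
    by (simp add: norm_mult)
qed

lemma unimodular_minors_entry:
  assumes "unimodular_minors m n a" "i < m" "j < n" "a i j \<noteq> 0"
  shows "cmod (a i j) = 1"
proof -
  have "cmod (det (mat 1 1 (\<lambda>(s, t). a i j))) \<in> {0, 1}"
    using assms(1)[unfolded unimodular_minors_def, rule_format, of 1 "\<lambda>_. i" "\<lambda>_. j"] assms(2,3)
    by simp
  then show ?thesis
    using assms(4) by (simp add: det_single)
qed

section \<open>Cycles of the bipartite graph\<close>

text \<open>The matrix \<open>b\<close> is the two-diagonal matrix of a path, and \<open>v\<close>
  is a column closing it to a cycle. In the expansion along that column, deleting row 0 leaves an
  upper triangular matrix and deleting row \<open>k\<close> a lower triangular one. The two terms
  belong to the two perfect matchings of the cycle.\<close>

lemma det_induced_cycle: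
  fixes b :: "nat \<Rightarrow> nat \<Rightarrow> 'b::comm_ring_1"
  assumes k: "0 < k"
    and v: "\<And>s. 0 < s \<Longrightarrow> s < k \<Longrightarrow> v s = 0"
    and b: "\<And>s t. s \<le> k \<Longrightarrow> t < k \<Longrightarrow> b s t \<noteq> 0 \<Longrightarrow> s = t \<or> s = Suc t"
  shows "det (mat (Suc k) (Suc k) (\<lambda>(s, t). if t < k then b s t else v s)) =
    v 0 * ((-1) ^ k * (\<Prod>t = 0..<k. b (Suc t) t)) + v k * (\<Prod>t = 0..<k. b t t)"
proof -
  let ?M = "mat (Suc k) (Suc k) (\<lambda>(s, t). if t < k then b s t else v s)"
  have "det ?M = (\<Sum>s<Suc k. ?M $$ (s, k) * cofactor ?M s k)"
    by (rule laplace_expansion_column) auto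
  also have "\<dots> = (\<Sum>s\<in>{0, k}. ?M $$ (s, k) * cofactor ?M s k)"
    using v by (intro sum.mono_neutral_right) auto
  also have "\<dots> = v 0 * cofactor ?M 0 k + v k * cofactor ?M k k"
    using k by simp
  also have "cofactor ?M 0 k = (-1) ^ k * (\<Prod>t = 0..<k. b (Suc t) t)"
  proof -
    have "mat_delete ?M 0 k = mat k k (\<lambda>(s, t). b (Suc s) t)"
      by (rule eq_matI) (auto simp: mat_delete_def)
    moreover have "det (mat k k (\<lambda>(s, t). b (Suc s) t)) =
        prod_list (diag_mat (mat k k (\<lambda>(s, t). b (Suc s) t)))"
    proof (rule det_upper_triangular[of _ k])
      have "b (Suc s) t = 0" if "t < s" "s < k" for s t
        using b[of "Suc s" t] that by auto
      then show "upper_triangular (mat k k (\<lambda>(s, t). b (Suc s) t))"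
        by (simp add: upper_triangular_def)
    qed simp
    ultimately show ?thesis
      by (simp add: cofactor_def prod_list_diag_prod)
  qed
  also have "cofactor ?M k k = (\<Prod>t = 0..<k. b t t)"
  proof -
    have "mat_delete ?M k k = mat k k (\<lambda>(s, t). b s t)"
      by (rule eq_matI) (auto simp: mat_delete_def)
    moreover have "det (mat k k (\<lambda>(s, t). b s t)) =
        prod_list (diag_mat (mat k k (\<lambda>(s, t). b s t)))"
    proof (rule det_lower_triangular[of k])
      fix s t assume "s < t" "t < k"
      then show "mat k k (\<lambda>(s, t). b s t) $$ (s, t) = 0"
        using b[of s t] by auto
    qed simp
    ultimately show ?thesis
      by (simp add: cofactor_def prod_list_diag_prod)
  qed
  finally show ?thesis .
qed

text \<open>The rows \<open>i\<close> and columns \<open>j\<close> alternate along a walk that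
  column \<open>n\<close> closes up. By strong induction on its length, an interior row meeting
  column \<open>n\<close> splits the closed walk in two, and a chord shortens it; otherwise the
  determinant has only the two terms of an induced cycle. The walk may repeat vertices, since
  \<open>unimodular_minors\<close> admits repeated indices.\<close>

lemma walk_ratio_in_Z6:
  assumes a: "unimodular_minors m (Suc n) a"
    and Z6: "\<And>i j. i < m \<Longrightarrow> j < n \<Longrightarrow> a i j \<in> insert 0 Z6"
    and rows: "\<And>s. s \<le> k \<Longrightarrow> i s < m"
    and walk: "\<And>t. t < k \<Longrightarrow> j t < n \<and> a (i t) (j t) \<noteq> 0 \<and> a (i (Suc t)) (j t) \<noteq> 0"
    and ends: "a (i 0) n \<noteq> 0" "a (i k) n \<noteq> 0"
  shows "a (i 0) n / a (i k) n \<in> Z6"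
  using rows walk ends
proof (induction k arbitrary: i j rule: less_induct)
  case (less k)
  note rows = less.prems(1) and walk = less.prems(2) and ends = less.prems(3,4)
  \<comment> \<open>Column \<open>j t\<close> is joined by the walk itself to rows
    \<open>i t\<close> and \<open>i (Suc t)\<close>. A nonzero entry in any other row of the walk is
    a chord, hence the bounds \<open>s < t\<close> and \<open>Suc t < s\<close>.\<close>
  consider (trivial) "k = 0"
    | (split) s where "0 < s" "s < k" "a (i s) n \<noteq> 0"
    | (chord_forward) s t where "s < t" "t < k" "a (i s) (j t) \<noteq> 0"
    | (chord_backward) s t where "Suc t < s" "s \<le> k" "a (i s) (j t) \<noteq> 0"
    | (induced) "0 < k" "\<And>s. 0 < s \<Longrightarrow> s < k \<Longrightarrow> a (i s) n = 0"
        "\<And>s t. s \<le> k \<Longrightarrow> t < k \<Longrightarrow> a (i s) (j t) \<noteq> 0 \<Longrightarrow> s = t \<or> s = Suc t"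
    by (metis Suc_lessI linorder_neqE_nat not_gr_zero)
  then show ?case
  proof cases
    case trivial
    then show ?thesis using ends by (simp add: Z6_def)
  next
    case split
    have "a (i 0) n / a (i s) n \<in> Z6"
      using split by (intro less.IH[of s i j] rows walk ends) auto
    moreover have "a (i (0 + s)) n / a (i (k - s + s)) n \<in> Z6"
      using split rows walk ends by (intro less.IH[of "k - s" "\<lambda>u. i (u + s)" "\<lambda>u. j (u + s)"]) auto
    ultimately have "(a (i 0) n / a (i s) n) * (a (i s) n / a (i k) n) \<in> Z6"
      using split by (intro Z6_mult) auto
    then show ?thesis
      using split by simp
  next
    case chord_forward
    \<comment> \<open>The shortened walk goes from row \<open>i s\<close> through column
      \<open>j t\<close> straight to row \<open>i (Suc t)\<close>. Since \<open>t < k\<close>, it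
      still ends in row \<open>i k\<close>.\<close>
    let ?d = "t - s"
    let ?i = "\<lambda>u. if u \<le> s then i u else i (u + ?d)"
    let ?j = "\<lambda>u. if u < s then j u else j (u + ?d)"
    have "a (?i 0) n / a (?i (k - ?d)) n \<in> Z6"
    proof (rule less.IH[of "k - ?d" ?i ?j])
      fix u assume u: "u < k - ?d"
      show "?j u < n \<and> a (?i u) (?j u) \<noteq> 0 \<and> a (?i (Suc u)) (?j u) \<noteq> 0"
        using walk[of u] walk[of "u + ?d"] chord_forward u by (cases u s rule: linorder_cases) auto
    qed (use chord_forward rows ends in auto)
    then show ?thesis
      using chord_forward by (auto split: if_splits)
  next
    case chord_backward
    \<comment> \<open>The shortened walk goes from row \<open>i t\<close> through column
      \<open>j t\<close> straight to row \<open>i s\<close>.\<close>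
    let ?d = "s - Suc t"
    let ?i = "\<lambda>u. if u \<le> t then i u else i (u + ?d)"
    let ?j = "\<lambda>u. if u \<le> t then j u else j (u + ?d)"
    have "a (?i 0) n / a (?i (k - ?d)) n \<in> Z6"
    proof (rule less.IH[of "k - ?d" ?i ?j])
      fix u assume u: "u < k - ?d"
      show "?j u < n \<and> a (?i u) (?j u) \<noteq> 0 \<and> a (?i (Suc u)) (?j u) \<noteq> 0"
        using walk[of u] walk[of "u + ?d"] chord_backward u by (cases u t rule: linorder_cases) auto
    qed (use chord_backward rows ends in auto)
    then show ?thesis
      using chord_backward by (auto split: if_splits)
  next
    case induced
    let ?j = "\<lambda>t. if t < k then j t else n"
    let ?P = "\<Prod>t = 0..<k. a (i (Suc t)) (j t)" and ?Q = "\<Prod>t = 0..<k. a (i t) (j t)"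
    let ?x = "a (i 0) n" and ?y = "a (i k) n"
    have entry: "a (i s) (j t) \<in> Z6" if "s \<le> k" "t < k" "a (i s) (j t) \<noteq> 0" for s t
      using Z6[of "i s" "j t"] rows walk that by auto
    have PQ: "?P \<in> Z6" "?Q \<in> Z6"
      using walk entry by (auto intro!: Z6_prod)
    have "cmod (det (mat (Suc k) (Suc k) (\<lambda>(s, t). a (i s) (?j t)))) \<in> {0, 1}"
      using rows walk by (intro unimodular_minorsD[OF a]) (simp_all add: less_SucI)
    moreover have "mat (Suc k) (Suc k) (\<lambda>(s, t). a (i s) (?j t)) =
        mat (Suc k) (Suc k) (\<lambda>(s, t). if t < k then a (i s) (j t) else a (i s) n)"
      by (rule eq_matI) auto
    ultimately have det: "cmod (?x * ((-1) ^ k * ?P) + ?y * ?Q) \<in> {0, 1}"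
      using det_induced_cycle[of k "\<lambda>s. a (i s) n" "\<lambda>s t. a (i s) (j t)"] induced by simp
    \<comment> \<open>Dividing the determinant by \<open>?y * ?Q\<close>, which has modulus 1, turns
      it into \<open>1 + u\<close> with \<open>u = ?x / ?y * w\<close>, ready for
      \<open>unit_shift_in_Z6\<close>. The factor \<open>w\<close> involves only the already
      normalised columns.\<close>
    define w where "w = (-1) ^ k * ?P / ?Q"
    have w: "w \<in> Z6"
      unfolding w_def by (intro Z6_divide Z6_mult PQ Z6_minus_one_power)
    have xy: "cmod ?x = 1" "cmod ?y = 1"
      using a ends rows by (auto intro: unimodular_minors_entry)
    have Q: "cmod ?Q = 1" and w1: "cmod w = 1"
      using PQ w Z6_subset_U1 by (auto simp: U1_def)
    have "?x * ((-1) ^ k * ?P) + ?y * ?Q = ?y * ?Q * (1 + ?x / ?y * w)"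
      using ends Z6_nonzero[OF PQ(2)] by (simp add: w_def field_simps)
    then have "cmod (1 + ?x / ?y * w) \<in> {0, 1}"
      using det xy Q by (simp add: norm_mult)
    then have "?x / ?y * w \<in> Z6"
      using xy w1 by (intro unit_shift_in_Z6) (auto simp: norm_mult norm_divide)
    then have "?x / ?y * w / w \<in> Z6"
      using w by (rule Z6_divide)
    then show ?thesis
      using Z6_nonzero[OF w] by simp
  qed
qed

text \<open>A chain of rows in which neighbours share a nonzero column is unrolled into a walk for
  \<open>walk_ratio_in_Z6\<close>.\<close>

lemma connected_ratio_in_Z6:
  assumes a: "unimodular_minors m (Suc n) a"
    and Z6: "\<And>i j. i < m \<Longrightarrow> j < n \<Longrightarrow> a i j \<in> insert 0 Z6"
    and conn: "(\<lambda>x y. x < m \<and> y < m \<and> (\<exists>j<n. a x j \<noteq> 0 \<and> a y j \<noteq> 0))\<^sup>*\<^sup>* x y"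
    and x: "x < m" and ends: "a x n \<noteq> 0" "a y n \<noteq> 0"
  shows "a x n / a y n \<in> Z6"
proof -
  let ?R = "\<lambda>x y. x < m \<and> y < m \<and> (\<exists>j<n. a x j \<noteq> 0 \<and> a y j \<noteq> 0)"
  obtain k where "(?R ^^ k) x y"
    using conn by (auto simp: rtranclp_power)
  then obtain i where i: "i 0 = x" "i k = y" "\<And>t. t < k \<Longrightarrow> ?R (i t) (i (Suc t))"
    by (auto simp: relpowp_fun_conv)
  then have "\<forall>t\<in>{..<k}. \<exists>j. j < n \<and> a (i t) j \<noteq> 0 \<and> a (i (Suc t)) j \<noteq> 0"
    by blast
  then obtain j where "\<forall>t\<in>{..<k}. j t < n \<and> a (i t) (j t) \<noteq> 0 \<and> a (i (Suc t)) (j t) \<noteq> 0"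
    by metis
  moreover have "i s < m" if "s \<le> k" for s
    using that i x by (cases s) auto
  ultimately have "a (i 0) n / a (i k) n \<in> Z6"
    using ends i by (intro walk_ratio_in_Z6[OF a Z6, of k i j]) auto
  then show ?thesis
    using i by simp
qed

section \<open>Normalising all entries to sixth roots of unity\<close>

text \<open>Columns are normalised one at a time. Once the first \<open>n\<close> are done, the
  nonzero entries of column \<open>n\<close> in one component of rows differ by factors in
  \<open>Z6\<close>. One factor per component therefore normalises column \<open>n\<close>, and the
  inverse factor on each earlier column of the component restores its entries.\<close>

lemma scaling_to_Z6:
  assumes "unimodular_minors m n a"
  shows "\<exists>r c. (\<forall>i. cmod (r i) = 1) \<and> (\<forall>j. cmod (c j) = 1) \<and>
    (\<forall>i<m. \<forall>j<n. r i * a i j * c j \<in> insert 0 Z6)"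
  using assms
proof (induction n)
  case 0
  show ?case by (intro exI[of _ "\<lambda>_. 1"]) simp
next
  case (Suc n)
  have "unimodular_minors m n a"
    using Suc.prems unfolding unimodular_minors_def by (meson less_SucI)
  then obtain r c where rc: "\<And>i. cmod (r i) = 1" "\<And>j. cmod (c j) = 1"
      and rcZ: "\<And>i j. i < m \<Longrightarrow> j < n \<Longrightarrow> r i * a i j * c j \<in> insert 0 Z6"
    using Suc.IH by blast
  define b where "b i j = r i * a i j * c j" for i j
  have b: "unimodular_minors m (Suc n) b"
    unfolding b_def using Suc.prems rc by (intro unimodular_minors_scale) auto
  have bZ: "b i j \<in> insert 0 Z6" if "i < m" "j < n" for i j
    using rcZ that by (simp add: b_def)
  define R where "R = (\<lambda>x y. x < m \<and> y < m \<and> (\<exists>j<n. b x j \<noteq> 0 \<and> b y j \<noteq> 0))"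
  have symR: "R x y \<Longrightarrow> R y x" for x y
    by (auto simp: R_def)
  have lt: "R\<^sup>*\<^sup>* x y \<Longrightarrow> x < m \<Longrightarrow> y < m" for x y
    by (induction rule: rtranclp_induct) (auto simp: R_def)
  \<comment> \<open>Rows in one component of the first \<open>n\<close> columns receive the same factor, chosen to
      normalise one entry of column \<open>n\<close> to 1.\<close>
  define Q where "Q x y \<longleftrightarrow> R\<^sup>*\<^sup>* x y \<and> b y n \<noteq> 0" for x y
  define \<rho> where "\<rho> x = (if x < m \<and> (\<exists>y. Q x y) then 1 / b (SOME y. Q x y) n else 1)" for x
  have \<rho>_eq: "\<rho> x = \<rho> y" if "R x y" for x y
  proof -
    have "R\<^sup>*\<^sup>* x z \<longleftrightarrow> R\<^sup>*\<^sup>* y z" for z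
      using that symR converse_rtranclp_into_rtranclp[of R] by blast
    \<comment> \<open>Equality of the whole predicates makes \<open>SOME\<close> choose the same
      representative row for \<open>x\<close> and \<open>y\<close>.\<close>
    then have "Q x = Q y"
      by (auto simp: Q_def fun_eq_iff)
    then show ?thesis
      using that by (auto simp: \<rho>_def R_def)
  qed
  have some: "Q x (SOME y. Q x y)" if "\<exists>y. Q x y" for x
    using that by (rule someI_ex)
  have \<rho>_norm: "cmod (\<rho> x) = 1" for x
  proof (cases "x < m \<and> (\<exists>y. Q x y)")
    case True
    then have "Q x (SOME y. Q x y)"
      using some by blast
    then have "cmod (b (SOME y. Q x y) n) = 1"
      using True lt by (intro unimodular_minors_entry[OF b]) (auto simp: Q_def)
    then show ?thesis
      by (simp add: \<rho>_def norm_divide)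
  qed (auto simp: \<rho>_def)
  \<comment> \<open>All rows meeting a column \<open>j < n\<close> lie in one component and share
    their factor, so any of them tells what to undo. For a zero column the choice is arbitrary, but
    every value of \<open>\<rho>\<close> has modulus 1. Column \<open>n\<close> keeps the factor
    1.\<close>
  define \<kappa> where "\<kappa> j = (if j < n then 1 / \<rho> (SOME x. x < m \<and> b x j \<noteq> 0) else 1)" for j
  have \<kappa>_norm: "cmod (\<kappa> j) = 1" for j
    by (simp add: \<kappa>_def norm_divide \<rho>_norm)
  have "\<rho> i * b i j * \<kappa> j \<in> insert 0 Z6" if ij: "i < m" "j < Suc n" for i j
  proof (cases "b i j = 0")
    case nz: False
    show ?thesis
    proof (cases "j < n")
      case True
      let ?x = "SOME x. x < m \<and> b x j \<noteq> 0"
      have "?x < m \<and> b ?x j \<noteq> 0"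
        using ij nz by (intro someI[of "\<lambda>x. x < m \<and> b x j \<noteq> 0"]) simp
      then have "R i ?x"
        using ij nz True by (auto simp: R_def)
      then have "\<rho> i = \<rho> ?x"
        by (rule \<rho>_eq)
      moreover have "\<rho> i \<noteq> 0"
        using \<rho>_norm[of i] by auto
      ultimately have "\<rho> i * b i j * \<kappa> j = b i j"
        using True by (simp add: \<kappa>_def)
      then show ?thesis
        using bZ[of i j] ij True by metis
    next
      case False
      then have j: "j = n"
        using ij by simp
      have "Q i i"
        using nz j by (simp add: Q_def)
      then have ex: "\<exists>y. Q i y" ..
      let ?y = "SOME y. Q i y"
      have "R\<^sup>*\<^sup>* i ?y" "b ?y n \<noteq> 0"
        using some[OF ex] by (auto simp: Q_def)
      then have "b i n / b ?y n \<in> Z6"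
        using nz j ij by (intro connected_ratio_in_Z6[OF b bZ]) (auto simp: R_def)
      then show ?thesis
        using j ij ex by (simp add: \<rho>_def \<kappa>_def)
    qed
  qed simp
  moreover have "\<rho> i * b i j * \<kappa> j = (\<rho> i * r i) * a i j * (c j * \<kappa> j)" for i j
    by (simp add: b_def)
  ultimately show ?case
    using rc \<rho>_norm \<kappa>_norm
    by (intro exI[of _ "\<lambda>i. \<rho> i * r i"] exI[of _ "\<lambda>j. c j * \<kappa> j"]) (simp add: norm_mult)
qed

section \<open>Scaling and the represented matroid\<close>

text \<open>Independence of a set of vectors becomes a condition on coefficients indexed by columns,
  the form in which scaling is a mere change of coefficients.\<close>

lemma cols_indep_iff:
  fixes A :: "'f::field mat"
  assumes J: "J \<subseteq> {..<dim_col A}"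
  shows "cols_indep A J \<longleftrightarrow>
    (\<forall>x. (\<forall>i<dim_row A. (\<Sum>j\<in>J. x j * A $$ (i, j)) = 0) \<longrightarrow> (\<forall>j\<in>J. x j = 0))"
proof -
  interpret vec_space "TYPE('f)" "dim_row A" .
  have fin: "finite J"
    using J finite_subset by blast
  have colsC: "col A ` J \<subseteq> carrier_vec (dim_row A)"
    by auto
  have index: "col A j $ i = A $$ (i, j)" if "j \<in> J" "i < dim_row A" for i j
    using that J by auto
  have sum_eq: "(\<Sum>v\<in>col A ` J. y v * v $ i) = (\<Sum>j\<in>J. y (col A j) * A $$ (i, j))"
    if "inj_on (col A) J" "i < dim_row A" for y i
    using that index by (simp add: sum.reindex)
  show ?thesis
  proof
    assume "cols_indep A J"
    then have inj: "inj_on (col A) J" and indpt: "\<not> lin_dep (col A ` J)"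
      by (auto simp: cols_indep_def)
    show "\<forall>x. (\<forall>i<dim_row A. (\<Sum>j\<in>J. x j * A $$ (i, j)) = 0) \<longrightarrow> (\<forall>j\<in>J. x j = 0)"
    proof (intro allI impI ballI, rule ccontr)
      fix x j
      assume x: "\<forall>i<dim_row A. (\<Sum>j\<in>J. x j * A $$ (i, j)) = 0" and j: "j \<in> J" "x j \<noteq> 0"
      \<comment> \<open>Injectivity of \<open>col A\<close> on \<open>J\<close> lets coefficients on
        indices be carried over to coefficients on vectors.\<close>
      define y where "y v = x (inv_into J (col A) v)" for v
      have y: "y (col A j) = x j" if "j \<in> J" for j
        using that inj by (simp add: y_def)
      have "lincomb y (col A ` J) = 0\<^sub>v (dim_row A)"
      proof (rule eq_vecI)
        fix i assume "i < dim_vec (0\<^sub>v (dim_row A))"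
        then show "lincomb y (col A ` J) $ i = 0\<^sub>v (dim_row A) $ i"
          using x y by (simp add: lincomb_index[OF _ colsC] sum_eq[OF inj])
      qed (use lincomb_dim[of "col A ` J"] fin colsC in auto)
      then have "lin_dep (col A ` J)"
        using j y fin by (intro lin_dep_crit[where A = "col A ` J" and a = y and v = "col A j"]) auto
      then show False
        using indpt by simp
    qed
  next
    assume R: "\<forall>x. (\<forall>i<dim_row A. (\<Sum>j\<in>J. x j * A $$ (i, j)) = 0) \<longrightarrow> (\<forall>j\<in>J. x j = 0)"
    have inj: "inj_on (col A) J"
    proof (rule inj_onI, rule ccontr)
      fix p q assume pq: "p \<in> J" "q \<in> J" "col A p = col A q" "p \<noteq> q"
      \<comment> \<open>Two equal columns satisfy the nontrivial relation with coefficients 1 and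
        -1.\<close>
      let ?x = "\<lambda>j. if j = p then 1 else if j = q then - 1 else (0::'f)"
      have "(\<Sum>j\<in>J. ?x j * A $$ (i, j)) = 0" if i: "i < dim_row A" for i
      proof -
        have "(\<Sum>j\<in>J. ?x j * A $$ (i, j)) = (\<Sum>j\<in>{p, q}. ?x j * A $$ (i, j))"
          using pq fin by (intro sum.mono_neutral_right) auto
        also have "\<dots> = A $$ (i, p) - A $$ (i, q)"
          using pq by simp
        also have "\<dots> = 0"
          using index[OF pq(1) i] index[OF pq(2) i] pq(3) by simp
        finally show ?thesis .
      qed
      then have "?x p = 0"
        using R[rule_format, of ?x p] pq(1) by simp
      then show False by simp
    qed
    have "\<not> lin_dep (col A ` J)"
    proof (rule finite_lin_indpt2)
      fix y assume y: "lincomb y (col A ` J) = 0\<^sub>v (dim_row A)"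
      have "(\<Sum>j\<in>J. y (col A j) * A $$ (i, j)) = 0" if i: "i < dim_row A" for i
      proof -
        have "lincomb y (col A ` J) $ i = 0"
          using y i by simp
        then show ?thesis
          using lincomb_index[OF i colsC] sum_eq[OF inj i] by simp
      qed
      then have "\<forall>j\<in>J. y (col A j) = 0"
        using R by (elim allE[of _ "\<lambda>j. y (col A j)"]) blast
      then show "\<forall>v\<in>col A ` J. y v = 0"
        by simp
    qed (use fin colsC in auto)
    then show "cols_indep A J"
      using inj by (simp add: cols_indep_def)
  qed
qed

text \<open>Nonzero row factors cancel from each equation, and column factors are absorbed by the
  bijection \<open>x j \<mapsto> x j * c j\<close> on coefficients.\<close>

lemma cols_indep_scale:
  fixes A :: "'f::field mat"
  assumes J: "J \<subseteq> {..<dim_col A}"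
    and r: "\<And>i. r i \<noteq> 0" and c: "\<And>j. c j \<noteq> 0"
  shows "cols_indep (mat (dim_row A) (dim_col A) (\<lambda>(i, j). r i * A $$ (i, j) * c j)) J \<longleftrightarrow>
    cols_indep A J"
proof -
  let ?B = "mat (dim_row A) (dim_col A) (\<lambda>(i, j). r i * A $$ (i, j) * c j)"
  have JB: "J \<subseteq> {..<dim_col ?B}"
    using J by simp
  have sum: "(\<Sum>j\<in>J. x j * ?B $$ (i, j)) = r i * (\<Sum>j\<in>J. (x j * c j) * A $$ (i, j))"
    if "i < dim_row A" for x i
    using that J by (auto simp: sum_distrib_left mult_ac intro!: sum.cong)
  show ?thesis
  proof
    assume L: "cols_indep ?B J"
    show "cols_indep A J"
      unfolding cols_indep_iff[OF J]
    proof (intro allI impI)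
      fix x assume x: "\<forall>i<dim_row A. (\<Sum>j\<in>J. x j * A $$ (i, j)) = 0"
      have "\<forall>i<dim_row ?B. (\<Sum>j\<in>J. (x j / c j) * ?B $$ (i, j)) = 0"
        unfolding dim_row_mat
      proof (intro allI impI)
        fix i assume "i < dim_row A"
        then show "(\<Sum>j\<in>J. (x j / c j) * ?B $$ (i, j)) = 0"
          unfolding sum[OF \<open>i < dim_row A\<close>] using x c by simp
      qed
      then have "\<forall>j\<in>J. x j / c j = 0"
        using L[unfolded cols_indep_iff[OF JB]] by (elim allE[of _ "\<lambda>j. x j / c j"]) blast
      then show "\<forall>j\<in>J. x j = 0"
        using c by simp
    qed
  next
    assume L: "cols_indep A J"
    show "cols_indep ?B J"
      unfolding cols_indep_iff[OF JB]
    proof (intro allI impI)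
      fix x assume "\<forall>i<dim_row ?B. (\<Sum>j\<in>J. x j * ?B $$ (i, j)) = 0"
      then have "\<forall>i<dim_row A. (\<Sum>j\<in>J. (x j * c j) * A $$ (i, j)) = 0"
        using r sum by simp
      then have "\<forall>j\<in>J. x j * c j = 0"
        using L unfolding cols_indep_iff[OF J] by (elim allE[of _ "\<lambda>j. x j * c j"]) blast
      then show "\<forall>j\<in>J. x j = 0"
        using c by simp
    qed
  qed
qed

lemma represents_scale:
  fixes A :: "'f::field mat"
  assumes "represents A E \<I>" and "\<And>i. r i \<noteq> 0" and "\<And>j. c j \<noteq> 0"
  shows "represents (mat (dim_row A) (dim_col A) (\<lambda>(i, j). r i * A $$ (i, j) * c j)) E \<I>"
proof -
  let ?B = "mat (dim_row A) (dim_col A) (\<lambda>(i, j). r i * A $$ (i, j) * c j)"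
  obtain f where "bij_betw f {..<dim_col A} E"
      and "\<I> = {f ` J |J. J \<subseteq> {..<dim_col A} \<and> cols_indep A J}"
    using assms(1) unfolding represents_def by blast
  moreover have "(J \<subseteq> {..<dim_col A} \<and> cols_indep A J) \<longleftrightarrow>
      (J \<subseteq> {..<dim_col ?B} \<and> cols_indep ?B J)" for J
    using cols_indep_scale[of J A r c] assms(2,3) by auto
  ultimately show ?thesis
    unfolding represents_def by (intro exI[of _ f]) simp
qed

section \<open>Subdeterminants as Eisenstein integers and the equality of the classes\<close>

lemma det_eisenstein:
  assumes "\<And>s t. s < k \<Longrightarrow> t < k \<Longrightarrow> b s t \<in> eisenstein"
  shows "det (mat k k (\<lambda>(s, t). b s t)) \<in> eisenstein"
proof -
  have sign: "signof p \<in> eisenstein" for p :: "nat \<Rightarrow> nat"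
    by (simp add: sign_def eisenstein_1 eisenstein_minus)
  have lt: "p s < k" if "p permutes {0..<k}" "s < k" for p s
    using that permutes_in_image[of p "{0..<k}" s] by auto
  show ?thesis
    using assms lt sign
    by (auto simp: det_def'[of _ k] intro!: eisenstein_sum eisenstein_mult eisenstein_prod)
qed

text \<open>Each nonzero subdeterminant is an Eisenstein integer by the Leibniz formula and has
  modulus 1 by \<open>u\<close>, so \<open>eisenstein_unit_in_Z6\<close> applies.\<close>

lemma FG_matrix_Z6I:
  assumes u: "unimodular_minors (dim_row A) (dim_col A) (\<lambda>i j. A $$ (i, j))"
    and Z6: "\<And>i j. i < dim_row A \<Longrightarrow> j < dim_col A \<Longrightarrow> A $$ (i, j) \<in> insert 0 Z6"
  shows "FG_matrix Z6 A"
  unfolding FG_matrix_def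
proof (intro allI impI)
  fix I J
  assume I: "I \<subseteq> {..<dim_row A}" and J: "J \<subseteq> {..<dim_col A}" and card: "card I = card J"
    and nz: "det (submatrix A I J) \<noteq> 0"
  have setI: "{x. x < dim_row A \<and> x \<in> I} = I" and setJ: "{x. x < dim_col A \<and> x \<in> J} = J"
    using I J by auto
  let ?M = "mat (card I) (card I) (\<lambda>(s, t). A $$ (pick I s, pick J t))"
  have S: "submatrix A I J = ?M"
    unfolding submatrix_def setI setJ card ..
  have bounds: "\<forall>s<card I. pick I s < dim_row A \<and> pick J s < dim_col A"
    using I J card pick_in_set_le by (metis lessThan_iff subsetD)
  have "det ?M \<in> eisenstein"
  proof (rule det_eisenstein)
    fix s t assume "s < card I" "t < card I"
    then have "A $$ (pick I s, pick J t) \<in> insert 0 Z6"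
      using bounds by (intro Z6) auto
    then show "A $$ (pick I s, pick J t) \<in> eisenstein"
      using Z6_subset_eisenstein eisenstein_0 by auto
  qed
  moreover have "cmod (det ?M) \<in> {0, 1}"
    using bounds by (intro unimodular_minorsD[OF u]) auto
  ultimately show "det (submatrix A I J) \<in> Z6"
    using nz S by (auto intro: eisenstein_unit_in_Z6)
qed

lemma FG_representable_mono:
  "G \<subseteq> H \<Longrightarrow> FG_representable G E \<I> \<Longrightarrow> FG_representable H E \<I>"
  unfolding FG_representable_def FG_matrix_def by (meson subsetD)

lemma FG_representable_U1_imp_Z6:
  assumes "FG_representable U1 E \<I>"
  shows "FG_representable Z6 E \<I>"
proof -
  obtain A where A: "FG_matrix U1 A" "represents A E \<I>"
    using assms unfolding FG_representable_def by blast
  have u: "unimodular_minors (dim_row A) (dim_col A) (\<lambda>i j. A $$ (i, j))"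
    using A(1) by (rule FG_matrix_U1_imp_unimodular_minors)
  obtain r c where rc: "\<And>i. cmod (r i) = 1" "\<And>j. cmod (c j) = 1"
      and Z: "\<And>i j. i < dim_row A \<Longrightarrow> j < dim_col A \<Longrightarrow> r i * A $$ (i, j) * c j \<in> insert 0 Z6"
    using scaling_to_Z6[OF u] by blast
  let ?B = "mat (dim_row A) (dim_col A) (\<lambda>(i, j). r i * A $$ (i, j) * c j)"
  have "unimodular_minors (dim_row A) (dim_col A) (\<lambda>i j. r i * A $$ (i, j) * c j)"
    using u rc by (intro unimodular_minors_scale) auto
  \<comment> \<open>Entries of \<open>?B\<close> are given by the scaling formula only inside its
    dimensions, so the minors are compared under the index bounds.\<close>
  moreover have "mat k k (\<lambda>(s, t). ?B $$ (i s, j t)) =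
      mat k k (\<lambda>(s, t). r (i s) * A $$ (i s, j t) * c (j t))"
    if "\<forall>s<k. i s < dim_row A \<and> j s < dim_col A" for k i j
    by (rule eq_matI) (use that in auto)
  ultimately have "unimodular_minors (dim_row ?B) (dim_col ?B) (\<lambda>i j. ?B $$ (i, j))"
    unfolding unimodular_minors_def by simp
  then have "FG_matrix Z6 ?B"
    by (rule FG_matrix_Z6I) (use Z in auto)
  moreover have "r i \<noteq> 0" "c j \<noteq> 0" for i j
    using rc(1)[of i] rc(2)[of j] by auto
  then have "represents ?B E \<I>"
    using A(2) by (intro represents_scale)
  ultimately show ?thesis
    unfolding FG_representable_def by blast
qed

theorem theorem8p9:
  shows "(complex_unimodular_matroids :: ('a set \<times> 'a set set) set) = sixth_root_of_unity_matroids"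
  unfolding complex_unimodular_matroids_def sixth_root_of_unity_matroids_def
  using FG_representable_U1_imp_Z6 FG_representable_mono[OF Z6_subset_U1] by blast

end
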